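(* Let $n\ge 2$ and $\mathbf b=(b_1,\dots,b_n)\in\mathbb Z_{>0}^n$. Then $$\begin{aligned}L(b_1,\dots,b_n)={}&b_1\,L(b_1+b_2,\,b_3,\dots,b_n)\\&+\sum_{\ell=2}^{n-1}\sum_{r=1}^{b_\ell}L\bigl(b_1,\dots,b_{\ell-2},\,b_{\ell-1}+b_\ell-r,\,b_{\ell+1}+r,\,b_{\ell+2},\dots,b_n\bigr)\\&+\sum_{r=1}^{b_n}L\bigl(b_1,\dots,b_{n-2},\,b_{n-1}+b_n-r\bigr).\end{aligned}$$
   Context: For $\mathbf b=(b_1,\dots,b_n)\in\mathbb Z_{>0}^n$, a $\mathbf b$-parking function is a list $(\beta_1,\dots,\beta_n)$ of positive integers whose nondecreasing rearrangement $\beta_1'\le\cdots\le\beta_n'$ satisfies $\beta_i'\le b_1+\cdots+b_i$ for all $i$. The $\mathbf b$-parking-function polytope $\mathfrak X_n(\mathbf b)\subset\mathbb R^n$ is the convex hull of all $\mathbf b$-parking functions of length $n$. For a positive integer vector $\mathbf b$ of any length $m\ge1$, $L(\mathbf b):=\#\bigl(\mathfrak X_m(\mathbf b)\cap\mathbb Z^m\bigr)$. *)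

theory Defs
  imports "HOL-Analysis.Analysis" "HOL-Analysis.Finite_Function_Topology"
begin

text \<open>A vector \<open>(b\<^sub>1, \<dots>, b\<^sub>n)\<close> is the list \<open>[b\<^sub>1, \<dots>, b\<^sub>n]\<close>; list positions count from 0, so the
  bound below is \<open>\<beta>'\<^sub>i\<^sub>+\<^sub>1 \<le> b\<^sub>1 + \<dots> + b\<^sub>i\<^sub>+\<^sub>1\<close> for the nondecreasing rearrangement
  \<open>\<beta>' = sort \<beta>\<close>.\<close>

definition parking_function :: "nat list \<Rightarrow> nat list \<Rightarrow> bool" where
  "parking_function b \<beta> \<longleftrightarrow>
     length \<beta> = length b \<and> (\<forall>x\<in>set \<beta>. 0 < x) \<and>
     (\<forall>i<length b. sort \<beta> ! i \<le> sum_list (take (Suc i) b))"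

text \<open>The length of \<open>b\<close> varies, so all the spaces \<open>\<real>\<^sup>n\<close> are taken inside the one real vector space
  \<^typ>\<open>nat \<Rightarrow>\<^sub>0 real\<close> of finitely supported sequences, \<open>\<real>\<^sup>n\<close> being the subspace of those supported on
  \<open>{..<n}\<close>. The function \<^const>\<open>Poly_Mapping.nth\<close> extends a list by zeros.\<close>

definition parking_polytope :: "nat list \<Rightarrow> (nat \<Rightarrow>\<^sub>0 real) set" where
  "parking_polytope b =
     convex hull ((\<lambda>\<beta>. Poly_Mapping.nth (map real \<beta>)) ` {\<beta>. parking_function b \<beta>})"

definition integer_lattice :: "nat \<Rightarrow> (nat \<Rightarrow>\<^sub>0 real) set" where
  "integer_lattice m =
     {x. Poly_Mapping.keys x \<subseteq> {..<m} \<and> (\<forall>i<m. Poly_Mapping.lookup x i \<in> \<int>)}"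

definition L :: "nat list \<Rightarrow> nat" where
  "L b = card (parking_polytope b \<inter> integer_lattice (length b))"

end

theory Submission
  imports Defs
begin

text \<open>Write \<open>S\<^sub>i = b\<^sub>1 + \<dots> + b\<^sub>i\<close> for the caps of the vector. The recursion counts the lattice points
  of the polytope by their last coordinate \<open>v\<close>, once it is known that the integer points of the polytope
  are exactly the positive integer vectors in which any \<open>k\<close> coordinates sum to at most the sum of the
  \<open>k\<close> largest caps, \<open>S\<^sub>n + \<dots> + S\<^sub>n\<^sub>-\<^sub>k\<^sub>+\<^sub>1\<close>. This condition is \<open>dominated\<close> below.

  Fix the last coordinate \<open>v\<close>. The other coordinates then have to satisfy two families of bounds, one from
  the choices of \<open>k\<close> coordinates that omit \<open>v\<close> and one from those that contain it. At each \<open>k\<close> one of the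
  two implies the other, and the stronger ones are again a condition of the same kind. If \<open>v \<le> S\<^sub>1\<close>, it is
  domination by the caps without \<open>S\<^sub>1\<close>. If \<open>S\<^sub>l\<^sub>-\<^sub>1 \<le> v \<le> S\<^sub>l\<close>, it is domination by the caps with
  the pair \<open>S\<^sub>l\<^sub>-\<^sub>1, S\<^sub>l\<close> replaced by the single cap \<open>S\<^sub>l\<^sub>-\<^sub>1 + S\<^sub>l - v\<close>. These are
  \<open>dominated_slice_last\<close> and \<open>dominated_slice\<close>. Writing \<open>v = S\<^sub>l\<^sub>-\<^sub>1 + r\<close> with \<open>1 \<le> r \<le> b\<^sub>l\<close>, the new
  cap is \<open>S\<^sub>l - r\<close>, so the new vector is the one in the term of the recursion with indices \<open>l\<close> and \<open>r\<close>;
  the values \<open>v \<le> S\<^sub>1 = b\<^sub>1\<close> all give the first term.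

  The same slicing shows that a dominated vector \<open>(x, v)\<close> lies in the polytope (\<open>dominated_in_hull\<close>).
  By induction \<open>x\<close> is a convex combination of parking functions \<open>\<beta>\<close> for the smaller caps, so only the
  points \<open>(\<beta>, v)\<close> have to be dealt with. If the entry \<open>w\<close> of \<open>\<beta>\<close> below the merged cap satisfies
  \<open>w \<le> S\<^sub>l\<^sub>-\<^sub>1\<close>, then \<open>(\<beta>, v)\<close> is itself a parking function; otherwise the pair \<open>(w, v)\<close>
  lies on the segment from \<open>(S\<^sub>l\<^sub>-\<^sub>1, w + v - S\<^sub>l\<^sub>-\<^sub>1)\<close> to its mirror image, and replacing
  the pair by either end turns \<open>(\<beta>, v)\<close> into a parking function. Conversely, domination is given by linear inequalities,
  and parking functions satisfy them.\<close>
section \<open>Domination by a decreasing list\<close>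

text \<open>For a decreasing list \<open>t\<close> this is weak submajorization of \<open>X\<close> by \<open>t\<close>. Decreasing order makes the sum
  of the \<open>k\<close> largest elements of \<open>t\<close> a prefix sum, and a multiset \<open>X\<close> builds in the symmetry under
  permutation of coordinates.\<close>
definition dominated :: "nat list \<Rightarrow> nat multiset \<Rightarrow> bool" where
  "dominated t X \<longleftrightarrow> (\<forall>A. A \<subseteq># X \<longrightarrow> sum_mset A \<le> sum_list (take (size A) t))"

lemma dominated_add_mset:
  "dominated t (add_mset v X) \<longleftrightarrow>
     (\<forall>A. A \<subseteq># X \<longrightarrow> sum_mset A \<le> sum_list (take (size A) t) \<and>
                      v + sum_mset A \<le> sum_list (take (Suc (size A)) t))"
  (is "?l \<longleftrightarrow> ?r")
proof
  assume l: ?l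
  show ?r
  proof (intro allI impI conjI)
    fix A assume A: "A \<subseteq># X"
    then have "A \<subseteq># add_mset v X"
      by (metis mset_subset_eq_insertD subset_mset.dual_order.trans subset_mset.order_refl
          subset_mset.less_imp_le)
    then show "sum_mset A \<le> sum_list (take (size A) t)"
      using l unfolding dominated_def by blast
    have "add_mset v A \<subseteq># add_mset v X" using A by simp
    then show "v + sum_mset A \<le> sum_list (take (Suc (size A)) t)"
      using l unfolding dominated_def by (auto dest!: spec[of _ "add_mset v A"])
  qed
next
  assume r: ?r
  show ?l
    unfolding dominated_def
  proof (intro allI impI)
    fix A assume A: "A \<subseteq># add_mset v X"
    show "sum_mset A \<le> sum_list (take (size A) t)"
    proof (cases "v \<in># A")
      case True
      then obtain B where B: "A = add_mset v B" by (meson multi_member_split)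
      with A have "B \<subseteq># X" by simp
      with r B show ?thesis by simp
    next
      case False
      with A have "A \<subseteq># X"
        by (metis add_mset_remove_trivial diff_single_trivial subset_eq_diff_conv add_mset_add_single)
      with r show ?thesis by simp
    qed
  qed
qed

lemma take_Suc_sum_le:
  fixes t :: "nat list"
  assumes "\<forall>y\<in>set (drop k t). y \<le> v"
  shows "sum_list (take (Suc k) t) \<le> sum_list (take k t) + v"
  using assms
proof (cases "k < length t")
  case True
  then have "t ! k \<in> set (drop k t)" by (metis Cons_nth_drop_Suc list.set_intros(1))
  with assms True show ?thesis by (simp add: take_Suc_conv_app_nth)
qed simp

lemma take_Suc_sum_ge:
  fixes t :: "nat list"
  assumes "k < length t" "\<forall>y\<in>set (take (Suc k) t). v \<le> y"
  shows "sum_list (take k t) + v \<le> sum_list (take (Suc k) t)"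
  using assms by (simp add: take_Suc_conv_app_nth)

text \<open>Each of the \<open>k \<le> length p\<close> bounds that involve \<open>v\<close> follows from the one without it, because the next
  element of the list is at least \<open>v\<close>. The size of \<open>X\<close> matters: it excludes selections of more than
  \<open>length p\<close> elements, for which there is no next element.\<close>
lemma dominated_slice_last:
  assumes "sorted_wrt (\<ge>) (p @ [a])" "v \<le> a" "size X = length p"
  shows "dominated (p @ [a]) (add_mset v X) \<longleftrightarrow> dominated p X"
proof -
  have ge: "\<forall>y\<in>set (p @ [a]). v \<le> y"
    using assms(1,2) by (auto simp: sorted_wrt_append)
  have step: "sum_list (take k p) + v \<le> sum_list (take (Suc k) (p @ [a]))"
    if "k \<le> length p" for k
  proof -
    have "\<forall>y\<in>set (take (Suc k) (p @ [a])). v \<le> y" using ge in_set_takeD by metis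
    with take_Suc_sum_ge[of k "p @ [a]" v] that show ?thesis by simp
  qed
  have *: "size A \<le> length p" if "A \<subseteq># X" for A
    using size_mset_mono[OF that] assms(3) by simp
  show ?thesis
    unfolding dominated_add_mset
    unfolding dominated_def
    using * step by (fastforce simp del: take_append simp: take_append[of _ p "[a]"])
qed

text \<open>Up to \<open>k = length p\<close> the bounds without \<open>v\<close> are the stronger ones; beyond it every further element of
  the list is at most \<open>v\<close>, and the bounds with \<open>v\<close> are stronger. The merged element \<open>c + a - v\<close> makes
  the prefix sums of the shorter list equal to the stronger bound on both sides of this threshold.\<close>
lemma dominated_slice:
  assumes "sorted_wrt (\<ge>) (p @ [c, a] @ q)" "a \<le> v" "v \<le> c"
  shows "dominated (p @ [c, a] @ q) (add_mset v X) \<longleftrightarrow> dominated (p @ [c + a - v] @ q) X"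
proof -
  let ?t = "p @ [c, a] @ q" and ?t' = "p @ [c + a - v] @ q"
  have small: "sum_list (take k ?t') = sum_list (take k ?t) \<and>
      sum_list (take k ?t) + v \<le> sum_list (take (Suc k) ?t)" if "k \<le> length p" for k
  proof -
    have "\<forall>y\<in>set (p @ [c]). v \<le> y"
      using assms by (auto simp: sorted_wrt_append)
    then have "\<forall>y\<in>set (take (Suc k) (p @ [c])). v \<le> y"
      using in_set_takeD by metis
    then have "sum_list (take k (p @ [c])) + v \<le> sum_list (take (Suc k) (p @ [c]))"
      using take_Suc_sum_ge[of k "p @ [c]" v] that by simp
    with that show ?thesis by (cases "k = length p") (simp_all add: Suc_diff_le)
  qed
  have large: "sum_list (take k ?t') + v = sum_list (take (Suc k) ?t) \<and>
      sum_list (take k ?t') \<le> sum_list (take k ?t)" if "\<not> k \<le> length p" for k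
  proof -
    define j where "j = k - Suc (length p)"
    have k: "k = Suc (length p + j)" using that by (simp add: j_def)
    have "\<forall>y\<in>set (drop k ?t). y \<le> v"
      using assms k by (fastforce simp: sorted_wrt_append dest: in_set_dropD)
    then have "sum_list (take (Suc k) ?t) \<le> sum_list (take k ?t) + v"
      by (rule take_Suc_sum_le)
    moreover have "sum_list (take k ?t') + v = sum_list (take (Suc k) ?t)"
      using assms(2,3) by (simp add: k)
    ultimately show ?thesis by linarith
  qed
  have "(sum_mset A \<le> sum_list (take (size A) ?t) \<and>
         v + sum_mset A \<le> sum_list (take (Suc (size A)) ?t)) \<longleftrightarrow>
        sum_mset A \<le> sum_list (take (size A) ?t')" for A
    using small[of "size A"] large[of "size A"] by (cases "size A \<le> length p") linarith+
  then show ?thesis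
    unfolding dominated_add_mset by (simp add: dominated_def)
qed

lemma dominated_imp_le:
  assumes "dominated t X" "x \<in># X"
  shows "x \<le> sum_list (take 1 t)"
  using assms unfolding dominated_def
  by (metis mset_subset_eq_single size_single sum_mset.singleton)

section \<open>Parking functions as matched multisets\<close>

lemma sum_take_le_Cons:
  fixes t :: "nat list"
  assumes "\<forall>z\<in>set t. z \<le> y"
  shows "sum_list (take k t) \<le> sum_list (take k (y # t))"
proof (cases k)
  case (Suc j)
  have "sum_list (take (Suc j) t) \<le> sum_list (take j t) + y"
    using assms by (intro take_Suc_sum_le) (auto dest: in_set_dropD)
  with Suc show ?thesis by simp
qed simp

lemma dominated_mset_self:
  assumes "sorted_wrt (\<ge>) t"
  shows "dominated t (mset t)"
  using assms
proof (induction t)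
  case Nil
  then show ?case by (simp add: dominated_def)
next
  case (Cons y t)
  then have IH: "dominated t (mset t)" and le: "\<forall>z\<in>set t. z \<le> y" by simp_all
  show ?case
    unfolding mset.simps dominated_add_mset
  proof (intro allI impI)
    fix A assume "A \<subseteq># mset t"
    then have "sum_mset A \<le> sum_list (take (size A) t)"
      using IH by (simp add: dominated_def)
    then show "sum_mset A \<le> sum_list (take (size A) (y # t)) \<and>
        y + sum_mset A \<le> sum_list (take (Suc (size A)) (y # t))"
      using sum_take_le_Cons[OF le, of "size A"] by simp
  qed
qed

text \<open>A matching of \<open>X\<close> into \<open>Y\<close> with every element below its partner restricts to any part of \<open>X\<close>.\<close>
lemma rel_mset_le_submultiset:
  fixes X Y :: "nat multiset"
  assumes "rel_mset (\<le>) X Y" "A \<subseteq># X"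
  shows "\<exists>B. B \<subseteq># Y \<and> size B = size A \<and> sum_mset A \<le> sum_mset B"
  using assms
proof (induction A arbitrary: X Y)
  case empty
  then show ?case by (intro exI[of _ "{#}"]) simp
next
  case (add x A)
  then obtain X' where X': "X = add_mset x X'" "A \<subseteq># X'"
    by (metis insert_subset_eq_iff insert_DiffM)
  with add.prems(1) obtain y Y' where Y': "Y = add_mset y Y'" "x \<le> y" "rel_mset (\<le>) X' Y'"
    by (metis msed_rel_invL)
  from add.IH[OF Y'(3) X'(2)] obtain B where
    "B \<subseteq># Y'" "size B = size A" "sum_mset A \<le> sum_mset B" by blast
  with Y' show ?case by (intro exI[of _ "add_mset y B"]) simp
qed

lemma dominated_if_rel_mset_le:
  assumes "sorted_wrt (\<ge>) t" "rel_mset (\<le>) X (mset t)"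
  shows "dominated t X"
  unfolding dominated_def
proof (intro allI impI)
  fix A assume "A \<subseteq># X"
  then obtain B where B: "B \<subseteq># mset t" "size B = size A" "sum_mset A \<le> sum_mset B"
    using rel_mset_le_submultiset[OF assms(2)] by blast
  then show "sum_mset A \<le> sum_list (take (size A) t)"
    using dominated_mset_self[OF assms(1)] unfolding dominated_def by fastforce
qed

lemma list_all2_le_insort:
  fixes xs ys :: "nat list"
  assumes "list_all2 (\<le>) xs ys" "sorted xs" "sorted ys" "a \<le> b"
  shows "list_all2 (\<le>) (insort a xs) (insort b ys)"
  using assms
proof (induction xs ys arbitrary: a b rule: list_all2_induct)
  case Nil
  then show ?case by simp
next
  case (Cons x xs y ys)
  have IH: "list_all2 (\<le>) (insort c xs) (insort d ys)" if "c \<le> d" for c d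
    using Cons that by simp
  have "list_all2 (\<le>) (x # xs) (insort b ys)" if "b > y"
  proof -
    have "insort x xs = x # xs" using Cons.prems(1) by (cases xs) auto
    then show ?thesis using IH[of x b] that Cons.hyps by simp
  qed
  moreover have "list_all2 (\<le>) (insort a xs) (y # ys)" if "b \<le> y" "a > x"
  proof -
    have "insort y ys = y # ys" using Cons.prems(2) by (cases ys) auto
    then show ?thesis using IH[of a y] that Cons.prems by simp
  qed
  ultimately show ?case using Cons.hyps Cons.prems IH[of a b] by auto
qed

lemma list_all2_le_sort:
  fixes xs ys :: "nat list"
  assumes "list_all2 (\<le>) xs ys"
  shows "list_all2 (\<le>) (sort xs) (sort ys)"
  using assms by (induction rule: list_all2_induct) (simp_all add: list_all2_le_insort)

text \<open>If some matching puts every entry of \<open>xs\<close> below an entry of \<open>t\<close>, then the matching in sorted order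
  does. The left-hand side is preferable in inductions, as elements can be added and removed at will
  without keeping track of their position in the sorted list.\<close>
lemma rel_mset_le_iff_sort:
  fixes xs t :: "nat list"
  shows "rel_mset (\<le>) (mset xs) (mset t) \<longleftrightarrow> list_all2 (\<le>) (sort xs) (sort t)"
proof
  assume "rel_mset (\<le>) (mset xs) (mset t)"
  then obtain ys zs where "mset ys = mset xs" "mset zs = mset t" "list_all2 (\<le>) ys zs"
    by (auto simp: rel_mset_def)
  moreover from this have "sort ys = sort xs" "sort zs = sort t"
    using properties_for_sort[of "sort xs" ys] properties_for_sort[of "sort t" zs] by simp_all
  ultimately show "list_all2 (\<le>) (sort xs) (sort t)"
    using list_all2_le_sort by metis
next
  assume "list_all2 (\<le>) (sort xs) (sort t)"
  then show "rel_mset (\<le>) (mset xs) (mset t)"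
    unfolding rel_mset_def by (metis mset_sort)
qed

fun partial_sums :: "nat \<Rightarrow> nat list \<Rightarrow> nat list" where
  "partial_sums c [] = []"
| "partial_sums c (x # xs) = (c + x) # partial_sums (c + x) xs"

lemma length_partial_sums [simp]: "length (partial_sums c b) = length b"
  by (induction b arbitrary: c) simp_all

lemma nth_partial_sums:
  "i < length b \<Longrightarrow> partial_sums c b ! i = c + sum_list (take (Suc i) b)"
  by (induction b arbitrary: c i) (auto simp: nth_Cons' take_Cons' split: nat.splits)

lemma partial_sums_append [simp]:
  "partial_sums c (xs @ ys) = partial_sums c xs @ partial_sums (c + sum_list xs) ys"
  by (induction xs arbitrary: c) (simp_all add: add.assoc)

lemma last_partial_sums: "b \<noteq> [] \<Longrightarrow> last (partial_sums c b) = c + sum_list b"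
proof (induction b arbitrary: c)
  case (Cons x b)
  have "partial_sums (c + x) b = [] \<longleftrightarrow> b = []"
    by (metis length_0_conv length_partial_sums)
  with Cons.IH[of "c + x"] show ?case by (cases "b = []") (simp_all add: add.assoc)
qed simp

lemma partial_sums_ge: "y \<in> set (partial_sums c b) \<Longrightarrow> c \<le> y"
  by (induction b arbitrary: c) fastforce+

lemma sorted_partial_sums [simp]: "sorted (partial_sums c b)"
  by (induction b arbitrary: c) (auto dest: partial_sums_ge)

lemma partial_sums_pos:
  "\<forall>x\<in>set b. 0 < x \<Longrightarrow> \<forall>y\<in>set (partial_sums c b). 0 < y"
  by (induction b arbitrary: c) simp_all

text \<open>The bounds \<open>S\<^sub>n, \<dots>, S\<^sub>1\<close>, in the decreasing order that \<^const>\<open>dominated\<close> asks for.\<close>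
abbreviation caps :: "nat list \<Rightarrow> nat list" where
  "caps b \<equiv> rev (partial_sums 0 b)"

lemma sorted_caps: "sorted_wrt (\<ge>) (caps b)"
  by (simp add: sorted_wrt_rev)

text \<open>Parking functions for an arbitrary list of caps instead of the partial sums of a vector; merging two
  caps is then a local change of the list.\<close>
definition parking_lists :: "nat list \<Rightarrow> nat list set" where
  "parking_lists t = {\<beta>. (\<forall>x\<in>set \<beta>. 0 < x) \<and> rel_mset (\<le>) (mset \<beta>) (mset t)}"

lemma length_parking_lists: "\<beta> \<in> parking_lists t \<Longrightarrow> length \<beta> = length t"
  unfolding parking_lists_def by (auto dest: rel_mset_size)

lemma parking_function_eq_parking_lists: "{\<beta>. parking_function b \<beta>} = parking_lists (caps b)"
proof -
  have "sort (partial_sums 0 b) = partial_sums 0 b"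
    by (simp add: sorted_sort_id)
  then show ?thesis
    unfolding parking_lists_def parking_function_def
    using rel_mset_le_iff_sort[of _ "partial_sums 0 b"]
    by (auto simp: list_all2_conv_all_nth nth_partial_sums)
qed

section \<open>The lattice points of the polytope\<close>

definition point :: "nat list \<Rightarrow> nat \<Rightarrow>\<^sub>0 real" where
  "point xs = Poly_Mapping.nth (map real xs)"

definition dominated_lists :: "nat list \<Rightarrow> nat list set" where
  "dominated_lists t = {xs. length xs = length t \<and> (\<forall>x\<in>set xs. 0 < x) \<and> dominated t (mset xs)}"

lemma lookup_point: "Poly_Mapping.lookup (point xs) i = (if i < length xs then real (xs ! i) else 0)"
  by (simp add: point_def nth_default_def)

lemma lookup_scaleR: "Poly_Mapping.lookup (r *\<^sub>R x) i = r * Poly_Mapping.lookup x i"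
  for x :: "nat \<Rightarrow>\<^sub>0 real"
proof -
  have "finite {i. r * Poly_Mapping.lookup x i \<noteq> 0}"
    by (rule finite_subset[OF _ finite_lookup[of x]]) auto
  then show ?thesis
    by (simp add: scaleR_poly_mapping_def Abs_poly_mapping_inverse)
qed

lemma point_snoc: "point (xs @ [v]) = Poly_Mapping.single (length xs) (real v) + point xs"
  by (rule poly_mapping_eqI)
    (auto simp: lookup_point lookup_add lookup_single nth_append when_def)

text \<open>Appending a fixed last coordinate to lists of equal length is a translation, and hence commutes with
  taking convex hulls.\<close>
lemma point_snoc_in_hull:
  assumes "point xs \<in> convex hull (point ` P)" "\<And>\<beta>. \<beta> \<in> P \<Longrightarrow> length \<beta> = length xs"
    and "\<And>\<beta>. \<beta> \<in> P \<Longrightarrow> point (\<beta> @ [v]) \<in> convex hull Q"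
  shows "point (xs @ [v]) \<in> convex hull Q"
proof -
  let ?e = "Poly_Mapping.single (length xs) (real v)"
  have "point (xs @ [v]) \<in> (\<lambda>x. ?e + x) ` (convex hull (point ` P))"
    unfolding point_snoc using assms(1) by (rule imageI)
  also have "\<dots> = convex hull ((\<lambda>x. ?e + x) ` point ` P)"
    by (simp add: convex_hull_translation)
  also have "\<dots> \<subseteq> convex hull Q"
  proof (rule hull_minimal)
    show "(\<lambda>x. ?e + x) ` point ` P \<subseteq> convex hull Q"
    proof clarify
      fix \<beta> assume "\<beta> \<in> P"
      with assms(2,3) point_snoc[of \<beta> v] show "?e + point \<beta> \<in> convex hull Q" by metis
    qed
  qed (rule convex_convex_hull)
  finally show ?thesis .
qed

lemma between_in_convex:
  fixes x y z :: "nat \<Rightarrow>\<^sub>0 real"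
  assumes "convex C" "x \<in> C" "y \<in> C" "0 \<le> l" "l \<le> 1"
    and "\<And>i. Poly_Mapping.lookup z i =
      l * Poly_Mapping.lookup x i + (1 - l) * Poly_Mapping.lookup y i"
  shows "z \<in> C"
proof -
  have "z = l *\<^sub>R x + (1 - l) *\<^sub>R y"
    by (rule poly_mapping_eqI) (simp add: lookup_add lookup_scaleR assms(6))
  then show ?thesis using assms by (simp add: convexD)
qed

text \<open>Let \<open>w\<close> be the entry of \<open>\<beta>\<close> matched to the merged cap. If \<open>w \<le> a\<close>, then \<open>w\<close> and \<open>v\<close> can be matched to
  \<open>a\<close> and \<open>c\<close>. Otherwise \<open>a < w\<close> and \<open>a < v\<close>, so with \<open>d = w + v - a \<le> c\<close> the pair \<open>(w, v)\<close> lies on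
  the segment between \<open>(a, d)\<close> and \<open>(d, a)\<close>. Positivity of \<open>a\<close> is needed for the ends of the segment to be
  parking functions.\<close>
lemma parking_lists_snoc_in_hull:
  assumes \<beta>: "\<beta> \<in> parking_lists (p @ [c + a - v] @ q)"
    and v: "0 < a" "a < v" "v \<le> c"
  shows "point (\<beta> @ [v]) \<in> convex hull (point ` parking_lists (p @ [c, a] @ q))"
    (is "_ \<in> convex hull ?Q")
proof -
  let ?t = "p @ [c, a] @ q"
  have pos: "\<forall>x\<in>set \<beta>. 0 < x" using \<beta> by (simp add: parking_lists_def)
  have "rel_mset (\<le>) (mset \<beta>) (add_mset (c + a - v) (mset (p @ q)))"
    using \<beta> by (simp add: parking_lists_def)
  then obtain w M where M: "mset \<beta> = add_mset w M" "w \<le> c + a - v" "rel_mset (\<le>) M (mset (p @ q))"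
    by (metis msed_rel_invR)
  have vertex: "\<gamma> \<in> parking_lists ?t"
    if "mset \<gamma> = add_mset x (add_mset y M)" "0 < x" "0 < y" "x \<le> a \<and> y \<le> c \<or> y \<le> a \<and> x \<le> c"
    for \<gamma> x y
  proof -
    have "rel_mset (\<le>) (add_mset x (add_mset y M)) (add_mset a (add_mset c (mset (p @ q))))"
      using that(4)
    proof
      assume "x \<le> a \<and> y \<le> c"
      then show ?thesis using M(3) by (simp add: rel_mset_Plus)
    next
      assume "y \<le> a \<and> x \<le> c"
      then have "rel_mset (\<le>) (add_mset y (add_mset x M)) (add_mset a (add_mset c (mset (p @ q))))"
        using M(3) by (simp add: rel_mset_Plus)
      then show ?thesis by (simp add: add_mset_commute)
    qed
    moreover have "\<forall>z\<in>set \<gamma>. 0 < z"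
      using that(1-3) M(1) pos by (metis add_mset_commute insert_iff set_mset_add_mset_insert set_mset_mset)
    ultimately show ?thesis
      using that(1) by (simp add: parking_lists_def add_mset_commute)
  qed
  have "w \<in> set \<beta>" using M(1) by (metis set_mset_mset union_single_eq_member)
  then obtain j where j: "j < length \<beta>" "\<beta> ! j = w" by (auto simp: in_set_conv_nth)
  have "0 < w" using \<open>w \<in> set \<beta>\<close> pos by blast
  show ?thesis
  proof (cases "w \<le> a")
    case True
    have "\<beta> @ [v] \<in> parking_lists ?t"
      using M(1) True v \<open>0 < w\<close> by (intro vertex[of _ w v]) simp_all
    then show ?thesis by (intro hull_inc imageI)
  next
    case False
    define d where "d = w + v - a"
    define \<gamma> where "\<gamma> = \<beta>[j := a] @ [d]"
    define \<gamma>' where "\<gamma>' = \<beta>[j := d] @ [a]"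
    \<comment> \<open>The weight of \<open>(a, d)\<close>, determined by \<open>v = l * d + (1 - l) * a\<close>; the equation for \<open>w\<close> then
      follows from \<open>w + v = a + d\<close>.\<close>
    define l where "l = (real v - real a) / (real d - real a)"
    have d: "real d = real w + real v - real a" "0 < d" "d \<le> c"
      using False v M(2) by (simp_all add: d_def)
    have upd: "mset (\<beta>[j := x]) = add_mset x M" for x
      using j M(1) by (simp add: mset_update)
    have "\<gamma> \<in> parking_lists ?t" "\<gamma>' \<in> parking_lists ?t"
      unfolding \<gamma>_def \<gamma>'_def using v d
      by (intro vertex[of _ a d] vertex[of _ d a]; simp add: upd)+
    then have "point \<gamma> \<in> convex hull ?Q" "point \<gamma>' \<in> convex hull ?Q"
      by (auto intro: hull_inc)
    moreover have pos_l: "0 < real d - real a" using False v d by simp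
    moreover have "0 \<le> l" "l \<le> 1" using False v d pos_l by (simp_all add: l_def)
    moreover have "l * (real d - real a) = real v - real a" using pos_l by (simp add: l_def)
    then have "l * real d - l * real a = real v - real a" by (simp only: right_diff_distrib)
    then have w: "real w = l * real a + (1 - l) * real d"
      and v': "real v = l * real d + (1 - l) * real a"
      unfolding left_diff_distrib mult_1_left using d(1) by linarith+
    have combination: "Poly_Mapping.lookup (point (\<beta> @ [v])) i =
        l * Poly_Mapping.lookup (point \<gamma>) i + (1 - l) * Poly_Mapping.lookup (point \<gamma>') i" for i
    proof -
      consider "i = j" | "i = length \<beta>" | "i < length \<beta>" "i \<noteq> j" | "length \<beta> < i" by linarith
      then show ?thesis
        using j w v' by cases (simp_all add: lookup_point \<gamma>_def \<gamma>'_def nth_append left_diff_distrib)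
    qed
    ultimately show ?thesis
      using between_in_convex[OF convex_convex_hull _ _ _ _ combination] by blast
  qed
qed

lemma decreasing_split:
  fixes t :: "nat list"
  assumes "t \<noteq> []" "v \<le> hd t" "last t < v"
  shows "\<exists>p c a q. t = p @ [c, a] @ q \<and> a < v \<and> v \<le> c"
  using assms
proof (induction t)
  case (Cons x t)
  then have "t \<noteq> []" by auto
  show ?case
  proof (cases "v \<le> hd t")
    case True
    with Cons \<open>t \<noteq> []\<close> obtain p c a q where "t = p @ [c, a] @ q \<and> a < v \<and> v \<le> c" by auto
    then show ?thesis by (intro exI[of _ "x # p"]) auto
  next
    case False
    obtain y t' where "t = y # t'" using \<open>t \<noteq> []\<close> by (cases t) auto
    with Cons.prems False have "x # t = [] @ [x, y] @ t' \<and> y < v \<and> v \<le> x" by simp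
    then show ?thesis by blast
  qed
qed simp

text \<open>Induction along the last coordinate: the remaining coordinates are dominated by the shortened list,
  hence lie in its hull, and every vertex of that hull extended by the last coordinate lies in the
  hull for \<open>t\<close>.\<close>
lemma dominated_in_hull:
  assumes "sorted_wrt (\<ge>) t" "\<forall>y\<in>set t. 0 < y" "xs \<in> dominated_lists t"
  shows "point xs \<in> convex hull (point ` parking_lists t)"
  using assms
proof (induction "length t" arbitrary: t xs)
  case 0
  then have "t = []" "xs = []" by (simp_all add: dominated_lists_def)
  then have "xs \<in> parking_lists t" by (simp add: parking_lists_def rel_mset_Zero)
  then show ?case by (intro hull_inc imageI)
next
  case (Suc n)
  then have "t \<noteq> []" by auto
  have len: "length xs = length t" and xpos: "\<forall>x\<in>set xs. 0 < x" and dom: "dominated t (mset xs)"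
    using Suc.prems(3) by (simp_all add: dominated_lists_def)
  then obtain ys v where xs: "xs = ys @ [v]" using \<open>t \<noteq> []\<close> by (cases xs rule: rev_cases) auto
  have len_ys: "length ys = n" using len xs Suc.hyps(2) by simp
  have dom: "dominated t (add_mset v (mset ys))" using dom xs by simp
  have "0 < v" and ypos: "\<forall>x\<in>set ys. 0 < x" using xpos xs by simp_all
  show ?case
  proof (cases "v \<le> last t")
    case True
    define p a where "p = butlast t" and "a = last t"
    then have t: "t = p @ [a]" using \<open>t \<noteq> []\<close> by simp
    have len_p: "length p = n" using t Suc.hyps(2) by simp
    have "ys \<in> dominated_lists p"
      using dominated_slice_last[of p a v "mset ys"] Suc.prems(1) True dom ypos len_ys len_p
      by (simp add: dominated_lists_def t)
    moreover have "sorted_wrt (\<ge>) p" "\<forall>y\<in>set p. 0 < y"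
      using Suc.prems(1,2) by (simp_all add: t sorted_wrt_append)
    ultimately have "point ys \<in> convex hull (point ` parking_lists p)"
      using Suc.hyps(1) len_p by blast
    then show ?thesis unfolding xs
    proof (rule point_snoc_in_hull)
      fix \<beta> assume "\<beta> \<in> parking_lists p"
      then have "\<beta> @ [v] \<in> parking_lists t"
        using True \<open>0 < v\<close> by (auto simp: parking_lists_def t intro: rel_mset_Plus)
      then show "point (\<beta> @ [v]) \<in> convex hull (point ` parking_lists t)"
        by (intro hull_inc imageI)
    qed (simp add: length_parking_lists len_ys len_p)
  next
    case False
    have "v \<le> hd t"
      using dominated_imp_le[OF dom, of v] \<open>t \<noteq> []\<close> by (cases t) simp_all
    with False obtain p c a q where t: "t = p @ [c, a] @ q" and v: "a < v" "v \<le> c"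
      using decreasing_split[of t v] \<open>t \<noteq> []\<close> by force
    let ?t' = "p @ [c + a - v] @ q"
    have len_t': "length ?t' = n" using t Suc.hyps(2) by simp
    have "ys \<in> dominated_lists ?t'"
      using dominated_slice[of p c a q v "mset ys"] Suc.prems(1) v dom ypos len_ys len_t'
      by (simp add: dominated_lists_def t)
    moreover have "sorted_wrt (\<ge>) ?t'" "\<forall>y\<in>set ?t'. 0 < y"
      using Suc.prems(1,2) v by (fastforce simp: t sorted_wrt_append)+
    ultimately have "point ys \<in> convex hull (point ` parking_lists ?t')"
      using Suc.hyps(1) len_t' by blast
    then show ?thesis unfolding xs
    proof (rule point_snoc_in_hull)
      fix \<beta> assume "\<beta> \<in> parking_lists ?t'"
      then show "point (\<beta> @ [v]) \<in> convex hull (point ` parking_lists t)"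
        unfolding t using v Suc.prems(2) by (intro parking_lists_snoc_in_hull) (simp_all add: t)
    qed (use length_parking_lists len_ys len_t' in fastforce)
  qed
qed

text \<open>The inequalities of domination on real points. They range over index sets rather than submultisets of
  coordinates in order to be linear.\<close>
definition halfspaces :: "nat list \<Rightarrow> (nat \<Rightarrow>\<^sub>0 real) set" where
  "halfspaces t = {x. Poly_Mapping.keys x \<subseteq> {..<length t} \<and>
     (\<forall>i<length t. 1 \<le> Poly_Mapping.lookup x i) \<and>
     (\<forall>I\<subseteq>{..<length t}. (\<Sum>i\<in>I. Poly_Mapping.lookup x i) \<le> real (sum_list (take (card I) t)))}"

lemma convex_halfspaces: "convex (halfspaces t)"
proof (rule convexI)
  fix x y :: "nat \<Rightarrow>\<^sub>0 real" and u v :: real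
  assume x: "x \<in> halfspaces t" and y: "y \<in> halfspaces t" and uv: "0 \<le> u" "0 \<le> v" "u + v = 1"
  have lk: "Poly_Mapping.lookup (u *\<^sub>R x + v *\<^sub>R y) i =
    u * Poly_Mapping.lookup x i + v * Poly_Mapping.lookup y i" for i
    by (simp add: lookup_add lookup_scaleR)
  have comb_le: "u * r + v * s \<le> m" if "r \<le> m" "s \<le> m" for r s m :: real
    using uv that by (intro convex_bound_le)
  have comb_ge: "m \<le> u * r + v * s" if "m \<le> r" "m \<le> s" for r s m :: real
    using comb_le[of "-r" "-m" "-s"] that by simp
  have "Poly_Mapping.keys (u *\<^sub>R x + v *\<^sub>R y) \<subseteq> {..<length t}"
  proof
    fix i assume "i \<in> Poly_Mapping.keys (u *\<^sub>R x + v *\<^sub>R y)"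
    then have "i \<in> Poly_Mapping.keys x \<or> i \<in> Poly_Mapping.keys y"
      by (auto simp: in_keys_iff lk)
    then show "i \<in> {..<length t}" using x y by (auto simp: halfspaces_def)
  qed
  moreover have "1 \<le> Poly_Mapping.lookup (u *\<^sub>R x + v *\<^sub>R y) i" if "i < length t" for i
    using x y that by (simp add: lk halfspaces_def comb_ge)
  moreover have "(\<Sum>i\<in>I. Poly_Mapping.lookup (u *\<^sub>R x + v *\<^sub>R y) i) \<le> real (sum_list (take (card I) t))"
    if "I \<subseteq> {..<length t}" for I
    using x y that
    by (simp add: lk sum.distrib halfspaces_def comb_le flip: sum_distrib_left)
  ultimately show "u *\<^sub>R x + v *\<^sub>R y \<in> halfspaces t" by (simp add: halfspaces_def)
qed

lemma sum_lookup_point: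
  assumes "I \<subseteq> {..<length xs}"
  shows "(\<Sum>i\<in>I. Poly_Mapping.lookup (point xs) i) =
    real (sum_mset (image_mset ((!) xs) (mset_set I)))"
proof -
  have "(\<Sum>i\<in>I. Poly_Mapping.lookup (point xs) i) = (\<Sum>i\<in>I. real (xs ! i))"
    using assms by (intro sum.cong) (auto simp: lookup_point)
  then show ?thesis by (simp add: sum_unfold_sum_mset image_mset.compositionality comp_def)
qed

lemma mset_eq_image_nth: "mset xs = image_mset ((!) xs) (mset_set {..<length xs})"
  by (metis map_nth mset_map mset_upt atLeast0LessThan)

text \<open>A submultiset of the entries of a list is the family of entries at some set of positions, and vice
  versa, so the two forms of the inequalities agree.\<close>
lemma point_in_halfspaces_iff:
  assumes "length xs = length t"
  shows "point xs \<in> halfspaces t \<longleftrightarrow> xs \<in> dominated_lists t"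
proof -
  have "Poly_Mapping.keys (point xs) \<subseteq> {..<length t}"
    using assms by (auto simp: in_keys_iff lookup_point split: if_splits)
  moreover have "(\<forall>i<length t. 1 \<le> Poly_Mapping.lookup (point xs) i) \<longleftrightarrow> (\<forall>x\<in>set xs. 0 < x)"
    using assms by (auto simp: lookup_point all_set_conv_all_nth Suc_le_eq)
  moreover have "(\<forall>I\<subseteq>{..<length t}. (\<Sum>i\<in>I. Poly_Mapping.lookup (point xs) i)
      \<le> real (sum_list (take (card I) t))) \<longleftrightarrow> dominated t (mset xs)" (is "?l \<longleftrightarrow> ?r")
  proof
    assume l: ?l
    show ?r unfolding dominated_def
    proof (intro allI impI)
      fix A assume "A \<subseteq># mset xs"
      then obtain C where "image_mset ((!) xs) (mset_set {..<length xs}) = A + C"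
        by (metis mset_eq_image_nth mset_subset_eq_exists_conv)
      then obtain B D where B: "mset_set {..<length xs} = B + D" "A = image_mset ((!) xs) B"
        by (metis image_mset_eq_plusD)
      define I where "I = set_mset B"
      have sub: "B \<subseteq># mset_set {..<length xs}" using B(1) by simp
      then have I: "I \<subseteq> {..<length xs}" using set_mset_mono[OF sub] by (simp add: I_def)
      have "count B i = count (mset_set I) i" for i
      proof (cases "i \<in># B")
        case True
        then have "count B i \<le> 1"
          using mset_subset_eq_count[OF sub, of i] I by (auto simp: I_def)
        with True show ?thesis by (simp add: I_def le_antisym)
      qed (simp add: I_def not_in_iff)
      then have "B = mset_set I" by (intro multiset_eqI)
      then have A: "A = image_mset ((!) xs) (mset_set I)" and "size A = card I"
        using B(2) by simp_all
      moreover have "real (sum_mset A) \<le> real (sum_list (take (card I) t))"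
        using l I assms unfolding A sum_lookup_point[OF I, symmetric] by simp
      ultimately show "sum_mset A \<le> sum_list (take (size A) t)"
        by (simp only: of_nat_le_iff)
    qed
  next
    assume r: ?r
    show ?l
    proof (intro allI impI)
      fix I assume I: "I \<subseteq> {..<length t}"
      then have "image_mset ((!) xs) (mset_set I) \<subseteq># mset xs"
        unfolding mset_eq_image_nth[of xs] using assms
        by (intro image_mset_subseteq_mono subset_imp_msubset_mset_set) simp_all
      then have "sum_mset (image_mset ((!) xs) (mset_set I)) \<le> sum_list (take (card I) t)"
        using r unfolding dominated_def by (metis size_image_mset size_mset_set)
      moreover have "(\<Sum>i\<in>I. Poly_Mapping.lookup (point xs) i) =
          real (sum_mset (image_mset ((!) xs) (mset_set I)))"
        using I assms by (intro sum_lookup_point) simp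
      ultimately show "(\<Sum>i\<in>I. Poly_Mapping.lookup (point xs) i) \<le> real (sum_list (take (card I) t))"
        by (simp only: of_nat_le_iff)
    qed
  qed
  ultimately show ?thesis using assms by (simp add: halfspaces_def dominated_lists_def)
qed

lemma hull_parking_lists_subset:
  assumes "sorted_wrt (\<ge>) t"
  shows "convex hull (point ` parking_lists t) \<subseteq> halfspaces t"
proof (rule hull_minimal)
  show "point ` parking_lists t \<subseteq> halfspaces t"
  proof (clarify)
    fix \<beta> assume \<beta>: "\<beta> \<in> parking_lists t"
    then have "\<beta> \<in> dominated_lists t"
      using dominated_if_rel_mset_le[OF assms] length_parking_lists[OF \<beta>]
      by (simp add: dominated_lists_def parking_lists_def)
    then show "point \<beta> \<in> halfspaces t"
      using point_in_halfspaces_iff length_parking_lists[OF \<beta>] by blast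
  qed
qed (rule convex_halfspaces)

lemma inj_on_point: "inj_on point {xs. length xs = n}"
proof (rule inj_onI)
  fix xs ys :: "nat list"
  assume *: "xs \<in> {xs. length xs = n}" "ys \<in> {xs. length xs = n}" "point xs = point ys"
  show "xs = ys"
  proof (rule nth_equalityI)
    fix i assume "i < length xs"
    moreover have "Poly_Mapping.lookup (point xs) i = Poly_Mapping.lookup (point ys) i"
      using *(3) by simp
    ultimately show "xs ! i = ys ! i" using *(1,2) by (simp add: lookup_point)
  qed (use * in simp)
qed

text \<open>Positivity of the entries is essential: for \<open>b = [0, 5]\<close> there is no parking function at all, but
  \<open>[1, 1]\<close> is dominated by \<open>[5, 0]\<close>.\<close>
lemma L_eq_card_dominated_lists:
  assumes "\<forall>x\<in>set b. 0 < x"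
  shows "L b = card (dominated_lists (caps b))"
proof -
  let ?t = "caps b"
  have "parking_polytope b \<inter> integer_lattice (length b) = point ` dominated_lists ?t"
  proof (intro equalityI subsetI)
    fix x assume x: "x \<in> parking_polytope b \<inter> integer_lattice (length b)"
    then have hs: "x \<in> halfspaces ?t"
      using hull_parking_lists_subset[OF sorted_caps]
      by (auto simp: parking_polytope_def point_def[abs_def] parking_function_eq_parking_lists)
    define xs where "xs = map (\<lambda>i. nat \<lfloor>Poly_Mapping.lookup x i\<rfloor>) [0..<length b]"
    have "x = point xs"
    proof (rule poly_mapping_eqI)
      fix i
      show "Poly_Mapping.lookup x i = Poly_Mapping.lookup (point xs) i"
      proof (cases "i < length b")
        case True
        then have "1 \<le> Poly_Mapping.lookup x i" "Poly_Mapping.lookup x i \<in> \<int>"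
          using hs x by (auto simp: halfspaces_def integer_lattice_def)
        then show ?thesis
          using True by (auto simp: lookup_point xs_def elim: Ints_cases)
      next
        case False
        then have "i \<notin> Poly_Mapping.keys x" using x by (auto simp: integer_lattice_def)
        then show ?thesis
          using False by (simp add: lookup_point xs_def in_keys_iff)
      qed
    qed
    moreover have "length xs = length ?t" by (simp add: xs_def)
    then have "xs \<in> dominated_lists ?t"
      using hs point_in_halfspaces_iff \<open>x = point xs\<close> by metis
    ultimately show "x \<in> point ` dominated_lists ?t" by blast
  next
    fix x assume "x \<in> point ` dominated_lists ?t"
    then obtain xs where xs: "xs \<in> dominated_lists ?t" "x = point xs" by blast
    have "x \<in> convex hull (point ` parking_lists ?t)"
      using dominated_in_hull[OF sorted_caps _ xs(1)] partial_sums_pos[OF assms] xs(2) by simp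
    moreover have "x \<in> integer_lattice (length b)"
      using xs by (auto simp: integer_lattice_def in_keys_iff
          lookup_point dominated_lists_def split: if_splits)
    ultimately show "x \<in> parking_polytope b \<inter> integer_lattice (length b)"
      by (simp add: parking_polytope_def point_def[abs_def] parking_function_eq_parking_lists)
  qed
  moreover have "inj_on point (dominated_lists ?t)"
    by (rule inj_on_subset[OF inj_on_point[of "length ?t"]]) (auto simp: dominated_lists_def)
  ultimately show ?thesis by (simp add: L_def card_image)
qed

section \<open>Slicing by the last coordinate\<close>

definition slice :: "nat list \<Rightarrow> nat \<Rightarrow> nat list set" where
  "slice t v = {xs. xs @ [v] \<in> dominated_lists t}"

lemma finite_dominated_lists: "finite (dominated_lists t)"
proof (rule finite_subset)
  show "dominated_lists t \<subseteq> {xs. set xs \<subseteq> {..sum_list (take 1 t)} \<and> length xs = length t}"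
    by (auto simp: dominated_lists_def dest: dominated_imp_le)
qed (simp add: finite_lists_length_eq)

lemma card_dominated_lists:
  assumes "t \<noteq> []"
  shows "card (dominated_lists t) = (\<Sum>v=1..hd t. card (slice t v))"
proof -
  have "dominated_lists t = (\<Union>v\<in>{1..hd t}. (\<lambda>xs. xs @ [v]) ` slice t v)"
  proof (intro equalityI subsetI)
    fix xs assume xs: "xs \<in> dominated_lists t"
    then obtain ys v where ys: "xs = ys @ [v]"
      using assms by (cases xs rule: rev_cases) (auto simp: dominated_lists_def)
    with xs have "0 < v" "v \<le> sum_list (take 1 t)"
      using dominated_imp_le[of t "mset xs" v] by (auto simp: dominated_lists_def)
    then have "v \<in> {1..hd t}" using assms by (cases t) auto
    with xs ys show "xs \<in> (\<Union>v\<in>{1..hd t}. (\<lambda>xs. xs @ [v]) ` slice t v)"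
      by (auto simp: slice_def)
  qed (auto simp: slice_def)
  moreover have "finite (slice t v)" for v
    using finite_vimageI[OF finite_dominated_lists[of t], of "\<lambda>xs. xs @ [v]"]
    by (simp add: slice_def vimage_def inj_on_def)
  ultimately have "card (dominated_lists t) = (\<Sum>v\<in>{1..hd t}. card ((\<lambda>xs. xs @ [v]) ` slice t v))"
    by (simp only:) (rule card_UN_disjoint, auto)
  also have "\<dots> = (\<Sum>v=1..hd t. card (slice t v))"
    by (intro sum.cong card_image) (auto simp: inj_on_def)
  finally show ?thesis .
qed

lemma slice_last:
  assumes "sorted_wrt (\<ge>) (p @ [a])" "0 < v" "v \<le> a"
  shows "slice (p @ [a]) v = dominated_lists p"
  using dominated_slice_last[OF assms(1,3)] assms(2)
  by (auto simp: slice_def dominated_lists_def)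

lemma slice_inner:
  assumes "sorted_wrt (\<ge>) (p @ [c, a] @ q)" "0 < v" "a \<le> v" "v \<le> c"
  shows "slice (p @ [c, a] @ q) v = dominated_lists (p @ [c + a - v] @ q)"
  using dominated_slice[OF assms(1,3,4)] assms(2)
  by (auto simp: slice_def dominated_lists_def)

lemma card_slice_first:
  assumes "\<forall>z\<in>set (x # y # b). 0 < z" "0 < v" "v \<le> x"
  shows "card (slice (caps (x # y # b)) v) = L ((x + y) # b)"
proof -
  have "caps (x # y # b) = caps ((x + y) # b) @ [x]" by simp
  then have "slice (caps (x # y # b)) v = dominated_lists (caps ((x + y) # b))"
    using slice_last[of "caps ((x + y) # b)" x v] assms sorted_caps[of "x # y # b"] by metis
  then show ?thesis using L_eq_card_dominated_lists[of "(x + y) # b"] assms by simp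
qed

text \<open>The entries \<open>x, y, z\<close> contribute the caps \<open>s + x\<close>, \<open>s + x + y\<close> and \<open>s + x + y + z\<close>, where \<open>s\<close> is the sum of
  \<open>b\<close>. Slicing at \<open>s + x + r\<close> merges the first two into \<open>s + (x + y - r)\<close>, and the entry after it must grow
  to \<open>z + r\<close> for the next cap to stay the same.\<close>
lemma card_slice_middle:
  assumes "\<forall>w\<in>set (b @ [x, y, z] @ b'). 0 < w" "0 < r" "r \<le> y"
  shows "card (slice (caps (b @ [x, y, z] @ b')) (sum_list b + x + r)) =
    L (b @ [x + y - r, z + r] @ b')"
proof -
  define s where "s = sum_list b"
  define p where "p = rev (partial_sums (s + x + y + z) b') @ [s + x + y + z]"
  define q where "q = caps b"
  have 1: "caps (b @ [x, y, z] @ b') = p @ [s + x + y, s + x] @ q"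
    by (simp add: p_def q_def s_def)
  have "caps (b @ [x + y - r, z + r] @ b') = p @ [s + (x + y - r)] @ q"
    using assms(3) by (simp add: p_def q_def s_def add.assoc)
  moreover have "s + (x + y - r) = (s + x + y) + (s + x) - (s + x + r)"
    using assms(3) by simp
  ultimately have 2: "caps (b @ [x + y - r, z + r] @ b') =
      p @ [(s + x + y) + (s + x) - (s + x + r)] @ q" by (simp only:)
  have "slice (caps (b @ [x, y, z] @ b')) (s + x + r) =
      dominated_lists (caps (b @ [x + y - r, z + r] @ b'))"
    unfolding 1 2
    by (rule slice_inner) (use assms sorted_caps[of "b @ [x, y, z] @ b'"] 1 in simp_all)
  moreover have "\<forall>w\<in>set (b @ [x + y - r, z + r] @ b'). 0 < w" using assms by auto
  ultimately show ?thesis by (simp only: s_def L_eq_card_dominated_lists)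
qed

text \<open>As before, but there is no further cap to be kept, so the removed amount \<open>r\<close> is not passed on.\<close>
lemma card_slice_final:
  assumes "\<forall>w\<in>set (b @ [x, y]). 0 < w" "0 < r" "r \<le> y"
  shows "card (slice (caps (b @ [x, y])) (sum_list b + x + r)) = L (b @ [x + y - r])"
proof -
  define s where "s = sum_list b"
  have 1: "caps (b @ [x, y]) = [] @ [s + x + y, s + x] @ caps b"
    by (simp add: s_def)
  have "s + (x + y - r) = (s + x + y) + (s + x) - (s + x + r)"
    using assms(3) by simp
  then have 2: "caps (b @ [x + y - r]) = [] @ [(s + x + y) + (s + x) - (s + x + r)] @ caps b"
    by (simp add: s_def)
  have "slice (caps (b @ [x, y])) (s + x + r) = dominated_lists (caps (b @ [x + y - r]))"
    unfolding 1 2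
    by (rule slice_inner) (use assms sorted_caps[of "b @ [x, y]"] 1 in simp_all)
  moreover have "\<forall>w\<in>set (b @ [x + y - r]). 0 < w" using assms by auto
  ultimately show ?thesis by (simp only: s_def L_eq_card_dominated_lists)
qed

text \<open>The possible last coordinates \<open>1, \<dots>, S\<^sub>n\<close> are cut at \<open>S\<^sub>1, \<dots>, S\<^sub>n\<^sub>-\<^sub>1\<close>; the block ending at \<open>S\<^sub>l\<close> has
  length \<open>b\<^sub>l\<close>.\<close>
lemma sum_over_blocks:
  fixes g :: "nat \<Rightarrow> nat" and b :: "nat \<Rightarrow> nat"
  assumes "1 \<le> n"
  shows "(\<Sum>v=1..sum b {1..n}. g v) =
    (\<Sum>v=1..b 1. g v) + (\<Sum>l=2..n. \<Sum>r=1..b l. g (sum b {1..l-1} + r))"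
  using assms
proof (induction n rule: dec_induct)
  case base
  then show ?case by simp
next
  case (step n)
  let ?s = "sum b {1..n}"
  have "(\<Sum>v=1..?s + b (Suc n). g v) = (\<Sum>v=1..?s. g v) + (\<Sum>v=?s+1..?s + b (Suc n). g v)"
    by (rule sum.ub_add_nat) simp
  also have "(\<Sum>v=?s+1..?s + b (Suc n). g v) = (\<Sum>r=1..b (Suc n). g (?s + r))"
    using sum.shift_bounds_cl_nat_ivl[of g 1 ?s "b (Suc n)"] by (simp add: add.commute)
  finally show ?case using step by simp
qed

lemma sum_list_map_upt: "sum_list (map b [1..<l]) = sum b {1..l-1}" for b :: "nat \<Rightarrow> nat"
  by (cases l) (simp_all del: upt_Suc sum.op_ivl_Suc add: interv_sum_list_conv_sum_set_nat atLeastLessThanSuc_atLeastAtMost)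

theorem theorem4p1:
  fixes n :: nat and b :: "nat \<Rightarrow> nat"
  assumes "n \<ge> 2"
    and "\<And>i. i \<in> {1..n} \<Longrightarrow> b i > 0"
  shows "L (map b [1..<n+1]) =
      b 1 * L ((b 1 + b 2) # map b [3..<n+1])
    + (\<Sum>l=2..n-1. \<Sum>r=1..b l.
         L (map b [1..<l-1] @ [b (l-1) + b l - r, b (l+1) + r] @ map b [l+2..<n+1]))
    + (\<Sum>r=1..b n. L (map b [1..<n-1] @ [b (n-1) + b n - r]))"
proof -
  let ?B = "map b [1..<n+1]"
  let ?g = "\<lambda>v. card (slice (caps ?B) v)"
  have pos: "\<forall>x\<in>set ?B. 0 < x" using assms(2) by auto
  have sums: "sum b {1..l-1} = sum_list (map b [1..<l-1]) + b (l-1)" if "2 \<le> l" for l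
  proof -
    have "[1..<l] = [1..<l-1] @ [l-1]"
      using that upt_Suc_append[of 1 "l-1"] by simp
    then show ?thesis using sum_list_map_upt[of b l] by simp
  qed
  have "caps ?B \<noteq> []" using assms(1) by simp
  moreover have "hd (caps ?B) = sum b {1..n}"
    using assms(1) last_partial_sums[of ?B 0] sum_list_map_upt[of b "n+1"]
    by (simp add: hd_rev del: upt_Suc)
  ultimately have "L ?B = (\<Sum>v=1..sum b {1..n}. ?g v)"
    using L_eq_card_dominated_lists[OF pos] card_dominated_lists[of "caps ?B"] by simp
  also have "\<dots> = (\<Sum>v=1..b 1. ?g v) + (\<Sum>l=2..n. \<Sum>r=1..b l. ?g (sum b {1..l-1} + r))"
    using assms(1) by (intro sum_over_blocks) simp
  \<comment> \<open>For a last coordinate at most the smallest cap, the slice does not depend on it,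
    which produces the factor \<open>b 1\<close>.\<close>
  also have "(\<Sum>v=1..b 1. ?g v) = b 1 * L ((b 1 + b 2) # map b [3..<n+1])"
  proof -
    have "[1..<n+1] = 1 # 2 # [3..<n+1]"
      using assms(1) by (simp add: upt_conv_Cons numeral_2_eq_2 numeral_3_eq_3 del: upt_Suc)
    then have "?B = b 1 # b 2 # map b [3..<n+1]" by simp
    then have "?g v = L ((b 1 + b 2) # map b [3..<n+1])" if "v \<in> {1..b 1}" for v
      using that pos by (metis card_slice_first atLeastAtMost_iff less_eq_Suc_le One_nat_def)
    then show ?thesis by simp
  qed
  also have "(\<Sum>l=2..n. \<Sum>r=1..b l. ?g (sum b {1..l-1} + r)) =
      (\<Sum>l=2..n-1. \<Sum>r=1..b l. ?g (sum b {1..l-1} + r)) + (\<Sum>r=1..b n. ?g (sum b {1..n-1} + r))"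
    using assms(1) by (cases n) simp_all
  also have "(\<Sum>l=2..n-1. \<Sum>r=1..b l. ?g (sum b {1..l-1} + r)) =
      (\<Sum>l=2..n-1. \<Sum>r=1..b l.
         L (map b [1..<l-1] @ [b (l-1) + b l - r, b (l+1) + r] @ map b [l+2..<n+1]))"
  proof (intro sum.cong refl)
    fix l r assume l: "l \<in> {2..n-1}" and r: "r \<in> {1..b l}"
    have "l - 1 + (n + 2 - l) = n + 1" and "1 \<le> l - 1" using l by auto
    then have "[1..<n+1] = [1..<l-1] @ [l-1..<n+1]"
      by (metis upt_add_eq_append)
    also have "[l-1..<n+1] = [l-1, l, l+1] @ [l+2..<n+1]"
    proof -
      have "l - 1 < n + 1" "Suc (l - 1) = l" "l < n + 1" "l + 1 < n + 1" using l by auto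
      then show ?thesis by (simp add: upt_conv_Cons del: upt_Suc)
    qed
    finally have B: "?B = map b [1..<l-1] @ [b (l-1), b l, b (l+1)] @ map b [l+2..<n+1]"
      by simp
    have "sum b {1..l-1} = sum_list (map b [1..<l-1]) + b (l-1)" using sums[of l] l by simp
    then show "?g (sum b {1..l-1} + r) =
        L (map b [1..<l-1] @ [b (l-1) + b l - r, b (l+1) + r] @ map b [l+2..<n+1])"
      using card_slice_middle[OF pos[unfolded B], of r] r unfolding B by simp
  qed
  also have "(\<Sum>r=1..b n. ?g (sum b {1..n-1} + r)) =
      (\<Sum>r=1..b n. L (map b [1..<n-1] @ [b (n-1) + b n - r]))"
  proof (intro sum.cong refl)
    fix r assume r: "r \<in> {1..b n}"
    have "[1..<n+1] = [1..<n-1] @ [n-1, n]"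
      using assms(1) by (cases n; cases "n - 1") simp_all
    then have B: "?B = map b [1..<n-1] @ [b (n-1), b n]" by simp
    show "?g (sum b {1..n-1} + r) = L (map b [1..<n-1] @ [b (n-1) + b n - r])"
      using card_slice_final[OF pos[unfolded B], of r] r sums[OF assms(1)] unfolding B by simp
  qed
  finally show ?thesis by simp
qed

end
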